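(* Let $K\ge2$, $\mathcal{I}=\{(k,l):k,l\in\{1,\dots,K\},\ k+l\le K\}$, and let $M\in\mathbb{R}^{\mathcal{I}\times K}$ be the matrix whose row indexed by $(k,l)\in\mathcal{I}$ is $e_{k+l}-e_k-e_l$, where $e_k\in\mathbb{R}^K$ is the $k$-th standard basis vector. Then $M$ has rank exactly $K-1$, and the kernel of $M$ is the span of $(1,2,3,\dots,K)\in\mathbb{R}^K$. All $K-1$ non-zero eigenvalues of $M^\top M\in\mathbb{R}^{K\times K}$ are integers in the interval $[K+1,2K+1]$.
   Context: Rows are indexed by ordered pairs $(k,l)$, with $k=l$ allowed (in which case the row is $e_{2k}-2e_k$). The $K-1$ non-zero eigenvalues are counted with multiplicity. *)

theory Defs
  imports "Jordan_Normal_Form.DL_Rank" "Jordan_Normal_Form.Matrix_Kernel" "Jordan_Normal_Form.Char_Poly"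
begin

definition index_set :: "nat \<Rightarrow> (nat \<times> nat) set" where
  "index_set K = {(k, l). k \<in> {1..K} \<and> l \<in> {1..K} \<and> k + l \<le> K}"

text \<open>
  Vector and matrix entries are indexed from 0, so the \<open>k\<close>-th standard basis vector
  (\<open>k\<close> in \<open>{1..K}\<close>) is \<open>unit_vec K (k - 1)\<close>.
\<close>

definition std_basis :: "nat \<Rightarrow> nat \<Rightarrow> real vec" where
  "std_basis K k = unit_vec K (k - 1)"

text \<open>
  Matrix rows are indexed by an initial segment of the natural numbers, so the rows indexed by
  pairs are laid out along a list \<open>ps\<close> of pairs, which is meant to be a duplicate-free
  enumeration of \<open>index_set K\<close>.
\<close>

definition sum_matrix :: "nat \<Rightarrow> (nat \<times> nat) list \<Rightarrow> real mat" where
  "sum_matrix K ps =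
     mat_of_rows K (map (\<lambda>(k, l). std_basis K (k + l) - std_basis K k - std_basis K l) ps)"

end

theory Submission
  imports Defs
begin

text \<open>
  Summing over the rows shows that \<open>(M\<^sup>T M x)\<^sub>m = (2K + 1 - m) x\<^sub>m - 2 (x\<^bsub>K-m+1\<^esub> + \<dots> + x\<^sub>K)\<close>. This operator
  has explicit eigenvectors, supported on intervals \<open>{a..K - a}\<close> and \<open>{b + 1..K - b}\<close> and affine
  there up to one entry, with eigenvalues \<open>2K + 1 - a\<close> for \<open>2a + 2 \<le> K\<close> and \<open>K + 1 + b\<close> for
  \<open>2b + 3 \<le> K\<close>. Together with \<open>0\<close> these are \<open>K\<close> distinct numbers, hence all the roots of the
  characteristic polynomial, each of them simple. The kernel of \<open>M\<close> consists of the additive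
  vectors \<open>x\<^bsub>k+l\<^esub> = x\<^sub>k + x\<^sub>l\<close>, so \<open>x\<^sub>k = k x\<^sub>1\<close>, and rank-nullity gives the rank.
\<close>

section \<open>Tools: rank-nullity, lines, and polynomials with distinct roots\<close>

lemma (in vec_space) rank_plus_dim_mat_kernel:
  assumes A: "A \<in> carrier_mat n nc"
  shows "rank A + vectorspace.dim class_ring ((module_vec TYPE('a) nc)\<lparr>carrier := mat_kernel A\<rparr>) = nc"
proof -
  interpret NC: vec_space "TYPE('a)" nc .
  interpret lm: linear_map class_ring "module_vec TYPE('a) nc" "module_vec TYPE('a) n" "(*\<^sub>v) A"
  proof unfold_locales
    show "(*\<^sub>v) A \<in> LinearCombinations.module_hom class_ring (module_vec TYPE('a) nc) (module_vec TYPE('a) n)"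
      using A by (auto simp: LinearCombinations.module_hom_def module_vec_simps
          mult_add_distrib_mat_vec mult_mat_vec)
  qed
  \<comment> \<open>The image is the column space, whose dimension is \<open>rank\<close> by
    definition.\<close>
  have im: "lm.im = span (set (cols A))"
    using col_space_eq[OF A] A unfolding lm.im_def col_space_def
    by (auto simp: module_vec_simps)
  have ker: "lm.ker = mat_kernel A"
    unfolding lm.ker_def mat_kernel[OF A] by (auto simp: module_vec_simps)
  show ?thesis
    using lm.rank_nullity[OF NC.fin_dim] NC.dim_is_n unfolding im ker rank_def by simp
qed

lemma (in vec_space) span_singleton:
  assumes v: "v \<in> carrier_vec n"
  shows "span {v} = range (\<lambda>c. c \<cdot>\<^sub>v v)"
proof -
  have "lincomb a {v} = a v \<cdot>\<^sub>v v" for a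
    using v by (auto simp: lincomb_def)
  then have "span {v} = range (\<lambda>a. a v \<cdot>\<^sub>v v)"
    using finite_span[of "{v}"] v by (auto simp: module_vec_simps)
  also have "\<dots> = (\<lambda>c. c \<cdot>\<^sub>v v) ` range (\<lambda>a. a v)"
    by (simp add: image_image)
  also have "range (\<lambda>a. a v) = (UNIV :: 'a set)"
    by (auto intro!: range_eqI[of _ _ "\<lambda>_. c" for c])
  finally show ?thesis .
qed

lemma (in vec_space) dim_span_singleton:
  assumes v: "v \<in> carrier_vec n" "v \<noteq> 0\<^sub>v n"
  shows "vectorspace.dim class_ring (span_vs {v}) = 1"
proof -
  have "lin_indpt {v}"
  proof
    assume "lin_dep {v}"
    then obtain a where "lincomb a {v} = 0\<^sub>v n" "a v \<noteq> 0"
      using finite_lin_dep[of "{v}"] v by auto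
    moreover have "lincomb a {v} = a v \<cdot>\<^sub>v v"
      using v by (auto simp: lincomb_def)
    ultimately show False
      using v by (auto simp: vec_eq_iff)
  qed
  then have "maximal {v} (\<lambda>T. T \<subseteq> {v} \<and> lin_indpt T)"
    by (simp add: maximal_def subset_antisym)
  from dim_span[OF _ _ this] v show ?thesis by simp
qed

lemma sum_nth_distinct:
  assumes "distinct xs"
  shows "(\<Sum>i<length xs. f (xs ! i)) = sum f (set xs)"
  using assms by (simp add: sum.distinct_set_conv_list sum_list_sum_nth atLeast0LessThan)

text \<open>Every element of \<open>E\<close> occurs at least once in \<open>proots p\<close>, while
  the degree allows at most \<open>card E\<close> roots with multiplicity, so each occurs exactly
  once and nothing else does.\<close>

lemma proots_eqI_distinct_roots:
  fixes p :: "'a :: idom poly"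
  assumes "p \<noteq> 0" "finite E" "degree p \<le> card E" "\<And>x. x \<in> E \<Longrightarrow> poly p x = 0"
  shows "proots p = mset_set E"
proof -
  have "mset_set E \<subseteq># proots p"
    using assms by (intro mset_subset_eqI) (auto simp: count_mset_set' Suc_le_eq order_gt_0_iff)
  moreover have "size (proots p) \<le> size (mset_set E)"
    using size_proots_le[of p] assms by simp
  ultimately show ?thesis
    using mset_subset_size[of "mset_set E" "proots p"] by (auto simp: subset_mset.le_less)
qed

section \<open>Rows, kernel and rank of the matrix\<close>

lemma sum_matrix_carrier: "sum_matrix K ps \<in> carrier_mat (length ps) K"
  by (simp add: sum_matrix_def carrier_matI)

lemma sum_matrix_row:
  assumes "r < length ps" "ps ! r = (k, l)"
  shows "row (sum_matrix K ps) r = std_basis K (k + l) - std_basis K k - std_basis K l"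
  using assms by (simp add: sum_matrix_def std_basis_def)

lemma sum_matrix_mult_vec:
  assumes "r < length ps" "ps ! r = (k, l)" "(k, l) \<in> index_set K" "v \<in> carrier_vec K"
  shows "(sum_matrix K ps *\<^sub>v v) $ r = v $ (k + l - 1) - v $ (k - 1) - v $ (l - 1)"
proof -
  have "k - 1 < K" "l - 1 < K" "k + l - 1 < K"
    using assms(3) by (auto simp: index_set_def)
  then show ?thesis
    using assms sum_matrix_carrier[where K = K and ps = ps]
    by (simp add: sum_matrix_row[OF assms(1,2)] std_basis_def minus_scalar_prod_distrib[of _ K])
qed

lemma mat_kernel_sum_matrix:
  assumes "set ps = index_set K"
  shows "mat_kernel (sum_matrix K ps) = range (\<lambda>c. c \<cdot>\<^sub>v vec K (\<lambda>i. real (i + 1)))"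
proof (intro subset_antisym subsetI)
  fix v assume "v \<in> mat_kernel (sum_matrix K ps)"
  then have v: "v \<in> carrier_vec K" "sum_matrix K ps *\<^sub>v v = 0\<^sub>v (length ps)"
    using mat_kernelD[OF sum_matrix_carrier] by auto
  have step: "v $ (k + l - 1) = v $ (k - 1) + v $ (l - 1)" if "(k, l) \<in> index_set K" for k l
  proof -
    obtain r where "r < length ps" "ps ! r = (k, l)"
      using \<open>(k, l) \<in> index_set K\<close> assms by (metis in_set_conv_nth)
    then show ?thesis
      using sum_matrix_mult_vec[of r ps k l K v] that v by simp
  qed
  \<comment> \<open>The rows \<open>(k, 1)\<close> alone force linearity; entry \<open>i\<close>
    belongs to the index \<open>i + 1\<close>.\<close>
  have "v $ i = real (i + 1) * v $ 0" if "i < K" for i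
    using that
  proof (induction i)
    case (Suc i)
    then show ?case
      using step[of "Suc i" 1] by (simp add: index_set_def algebra_simps)
  qed simp
  from this[symmetric] have "((v $ 0) \<cdot>\<^sub>v vec K (\<lambda>i. real (i + 1))) $ i = v $ i" if "i < K" for i
    using that by (simp add: mult.commute)
  then have "v = (v $ 0) \<cdot>\<^sub>v vec K (\<lambda>i. real (i + 1))"
    using v(1) by (intro eq_vecI) auto
  then show "v \<in> range (\<lambda>c. c \<cdot>\<^sub>v vec K (\<lambda>i. real (i + 1)))"
    by blast
next
  fix v :: "real vec" assume "v \<in> range (\<lambda>c. c \<cdot>\<^sub>v vec K (\<lambda>i. real (i + 1)))"
  then obtain c where v: "v = c \<cdot>\<^sub>v vec K (\<lambda>i. real (i + 1))" by blast
  show "v \<in> mat_kernel (sum_matrix K ps)"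
  proof (rule mat_kernelI[OF sum_matrix_carrier])
    show "sum_matrix K ps *\<^sub>v v = 0\<^sub>v (length ps)"
    proof (rule eq_vecI)
      fix r assume r: "r < dim_vec (0\<^sub>v (length ps) :: real vec)"
      obtain k l where kl: "ps ! r = (k, l)" by force
      then have "(k, l) \<in> index_set K" using r assms nth_mem[of r ps] by simp
      moreover from this have "k - 1 < K" "l - 1 < K" "k + l - 1 < K" "k \<ge> 1" "l \<ge> 1"
        by (auto simp: index_set_def)
      ultimately show "(sum_matrix K ps *\<^sub>v v) $ r = 0\<^sub>v (length ps) $ r"
        using r sum_matrix_mult_vec[of r ps k l K v] kl
        by (simp add: v of_nat_diff algebra_simps)
    qed (use sum_matrix_carrier in auto)
  qed (simp add: v)
qed

lemma rank_sum_matrix: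
  assumes "set ps = index_set K" "K > 0"
  shows "vec_space.rank (length ps) (sum_matrix K ps) = K - 1"
proof -
  let ?u = "vec K (\<lambda>i. real (i + 1))"
  have "?u $ 0 \<noteq> 0\<^sub>v K $ 0" using assms(2) by simp
  then have "?u \<noteq> 0\<^sub>v K" by force
  then have "vectorspace.dim class_ring ((module_vec TYPE(real) K)\<lparr>carrier := mat_kernel (sum_matrix K ps)\<rparr>) = 1"
    using vec_space.dim_span_singleton[of ?u K] vec_space.span_singleton[of ?u K]
    by (simp add: mat_kernel_sum_matrix[OF assms(1)])
  then show ?thesis
    using vec_space.rank_plus_dim_mat_kernel[OF sum_matrix_carrier[where K = K and ps = ps]] by simp
qed

section \<open>The action of the Gram matrix\<close>

lemma index_set_eq_Sigma: "index_set K = Sigma {1..K} (\<lambda>k. {1..K - k})"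
  by (auto simp: index_set_def)

lemma sum_index_set_fst:
  assumes "p \<in> {1..K}"
  shows "(\<Sum>(k, l)\<in>index_set K. of_bool (k = p) * f k l) = (\<Sum>l = 1..K - p. f p l :: real)"
proof -
  have "(\<Sum>(k, l)\<in>index_set K. of_bool (k = p) * f k l)
      = (\<Sum>k = 1..K. of_bool (k = p) * (\<Sum>l = 1..K - k. f k l))"
    by (simp add: index_set_eq_Sigma sum.Sigma[symmetric] sum_distrib_left)
  also have "\<dots> = (\<Sum>l = 1..K - p. f p l)"
    using assms by simp
  finally show ?thesis .
qed

lemma sum_index_set_snd:
  assumes "p \<in> {1..K}"
  shows "(\<Sum>(k, l)\<in>index_set K. of_bool (l = p) * f k l) = (\<Sum>k = 1..K - p. f k p :: real)"
proof -
  have "(\<Sum>(k, l)\<in>index_set K. of_bool (l = p) * f k l) = (\<Sum>(k, l)\<in>index_set K. of_bool (k = p) * f l k)"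
    by (rule sum.reindex_bij_witness[of _ prod.swap prod.swap]) (auto simp: index_set_def)
  with sum_index_set_fst[OF assms, of "\<lambda>k l. f l k"] show ?thesis by simp
qed

lemma sum_index_set_plus:
  assumes "p \<le> K"
  shows "(\<Sum>(k, l)\<in>index_set K. of_bool (k + l = p) * f k l) = (\<Sum>k = 1..<p. f k (p - k) :: real)"
proof -
  have "(\<Sum>(k, l)\<in>index_set K. of_bool (k + l = p) * f k l)
      = (\<Sum>(k, l)\<in>{(k, l)\<in>index_set K. k + l = p}. f k l)"
    by (rule sum.mono_neutral_cong_right)
       (auto simp: index_set_eq_Sigma intro: finite_subset[of _ "{1..K} \<times> {1..K}"])
  also have "\<dots> = (\<Sum>k = 1..<p. f k (p - k))"
    by (rule sum.reindex_bij_witness[of _ "\<lambda>k. (k, p - k)" fst]) (use assms in \<open>auto simp: index_set_def\<close>)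
  finally show ?thesis .
qed

text \<open>The left side is entry \<open>p\<close> of the Gram matrix applied to \<open>x\<close>.
  In terms of prefix sums \<open>S\<close>, the contributions of \<open>S p\<close> cancel and only
  the tail \<open>S K - S (K - p)\<close> survives.\<close>

lemma sum_index_set_gram:
  fixes x :: "nat \<Rightarrow> real"
  assumes p: "p \<in> {1..K}"
  shows "(\<Sum>(k, l)\<in>index_set K. (of_bool (k + l = p) - of_bool (k = p) - of_bool (l = p)) * (x (k + l) - x k - x l))
    = (2 * real K + 1 - real p) * x p - 2 * (\<Sum>i = K - p + 1..K. x i)"
proof -
  define f where "f k l = x (k + l) - x k - x l" for k l
  define S where "S n = (\<Sum>i = 1..n. x i)" for n
  have split: "(\<Sum>i = a + 1..b. x i) = S b - S a" if "a \<le> b" for a b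
    unfolding S_def using that sum.ub_add_nat[of 1 a x "b - a"] by simp
  have flip: "(\<Sum>k = 1..<p. x (p - k)) = (\<Sum>k = 1..<p. x k)"
    by (rule sum.reindex_bij_witness[of _ "\<lambda>k. p - k" "\<lambda>k. p - k"]) auto
  have S_p: "(\<Sum>k = 1..<p. x k) = S p - x p"
    using p by (cases p) (auto simp: S_def atLeastLessThanSuc_atLeastAtMost)
  have "(\<Sum>(k, l)\<in>index_set K. of_bool (k + l = p) * f k l) = (\<Sum>k = 1..<p. x p - x k - x (p - k))"
    using p by (subst sum_index_set_plus) (auto simp: f_def)
  also have "\<dots> = (real p + 1) * x p - 2 * S p"
    using p unfolding sum_subtractf flip S_p by (simp add: of_nat_diff algebra_simps)
  finally have plus: "(\<Sum>(k, l)\<in>index_set K. of_bool (k + l = p) * f k l) = (real p + 1) * x p - 2 * S p" .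
  have "(\<Sum>l = 1..K - p. x (p + l)) = (\<Sum>i = p + 1..K. x i)"
    by (rule sum.reindex_bij_witness[of _ "\<lambda>i. i - p" "\<lambda>l. p + l"]) (use p in auto)
  then have f_sum: "(\<Sum>l = 1..K - p. f p l) = S K - S p - (real K - real p) * x p - S (K - p)"
    using p split[of p K] by (simp add: f_def sum_subtractf of_nat_diff S_def)
  \<comment> \<open>By symmetry the sums over \<open>k = p\<close> and \<open>l = p\<close> agree,
    which gives the factor 2 below.\<close>
  have f_sym: "f k l = f l k" for k l
    by (simp add: f_def add.commute)
  have "(\<Sum>(k, l)\<in>index_set K. (of_bool (k + l = p) - of_bool (k = p) - of_bool (l = p)) * f k l)
     = (\<Sum>(k, l)\<in>index_set K. of_bool (k + l = p) * f k l)
     - (\<Sum>(k, l)\<in>index_set K. of_bool (k = p) * f k l)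
     - (\<Sum>(k, l)\<in>index_set K. of_bool (l = p) * f k l)"
    by (simp add: sum_subtractf[symmetric] algebra_simps case_prod_unfold)
  also have "\<dots> = (real p + 1) * x p - 2 * S p - 2 * (\<Sum>l = 1..K - p. f p l)"
    unfolding plus sum_index_set_fst[OF p] sum_index_set_snd[OF p] f_sym[of _ p] by simp
  also have "\<dots> = (2 * real K + 1 - real p) * x p - 2 * (\<Sum>i = K - p + 1..K. x i)"
    unfolding f_sum using split[of "K - p" K] by (simp add: algebra_simps)
  finally show ?thesis
    unfolding f_def .
qed

lemma gram_mult_vec:
  fixes x :: "nat \<Rightarrow> real"
  assumes ps: "distinct ps" "set ps = index_set K" and m: "m < K"
  defines "M \<equiv> sum_matrix K ps"
  shows "((M\<^sup>T * M) *\<^sub>v vec K (\<lambda>i. x (i + 1))) $ m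
    = (2 * real K - real m) * x (m + 1) - 2 * (\<Sum>i = K - m..K. x i)"
proof -
  let ?v = "vec K (\<lambda>i. x (i + 1))"
  let ?c = "\<lambda>(k, l). (of_bool (k + l = m + 1) - of_bool (k = m + 1) - of_bool (l = m + 1)) * (x (k + l) - x k - x l)"
  have M: "M \<in> carrier_mat (length ps) K"
    unfolding M_def by (rule sum_matrix_carrier)
  have entry: "M $$ (r, m) * (M *\<^sub>v ?v) $ r = ?c (ps ! r)" if r: "r < length ps" for r
  proof -
    obtain k l where kl: "ps ! r = (k, l)" by force
    with r ps have mem: "(k, l) \<in> index_set K"
      using nth_mem[of r ps] by simp
    then have bounds: "k \<ge> 1" "l \<ge> 1" "k + l \<le> K" by (auto simp: index_set_def)
    have "M $$ (r, m) = row M r $ m"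
      using r m M by auto
    \<comment> \<open>For \<open>k = l\<close> the last two indicators add up, as the row of a pair
      \<open>(k, k)\<close> requires.\<close>
    also have "\<dots> = of_bool (k + l = m + 1) - of_bool (k = m + 1) - of_bool (l = m + 1)"
      using bounds m unfolding M_def sum_matrix_row[OF r kl]
      by (auto simp: std_basis_def unit_vec_def)
    moreover have "(M *\<^sub>v ?v) $ r = x (k + l) - x k - x l"
      using bounds unfolding M_def by (subst sum_matrix_mult_vec[OF r kl mem]) auto
    ultimately show ?thesis
      by (simp add: kl)
  qed
  have "(M\<^sup>T * M) *\<^sub>v ?v = M\<^sup>T *\<^sub>v (M *\<^sub>v ?v)"
    using M by (intro assoc_mult_mat_vec) auto
  also have "\<dots> $ m = (\<Sum>r<length ps. M $$ (r, m) * (M *\<^sub>v ?v) $ r)"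
    using M m by (auto simp: scalar_prod_def atLeast0LessThan)
  also have "\<dots> = (\<Sum>r<length ps. ?c (ps ! r))"
    using entry by (intro sum.cong) auto
  also have "\<dots> = sum ?c (index_set K)"
    using sum_nth_distinct[OF ps(1), of ?c] ps(2) by simp
  also have "\<dots> = (2 * real K - real m) * x (m + 1) - 2 * (\<Sum>i = K - m..K. x i)"
    using sum_index_set_gram[of "m + 1" K x] m by (simp add: Suc_diff_Suc)
  finally show ?thesis .
qed

section \<open>Explicit eigenvectors\<close>

text \<open>
  With \<open>\<lambda> = 2 * K + 1 - \<mu>\<close> the eigenvalue equation reads \<open>(\<mu> - m) * x m = 2 * (\<Sum>i = K - m + 1..K. x i)\<close>;
  the hypothesis \<open>rec\<close> is the difference of consecutive equations, and \<open>x 0\<close> is an auxiliary value.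
\<close>

lemma eigenvalue_gramI:
  fixes x :: "nat \<Rightarrow> real"
  assumes ps: "distinct ps" "set ps = index_set K"
    and rec: "\<And>m. m < K \<Longrightarrow> (\<mu> - real m - 1) * x (m + 1) - (\<mu> - real m) * x m = 2 * x (K - m)"
    and init: "\<mu> * x 0 = 0" and nz: "p \<in> {1..K}" "x p \<noteq> 0"
  shows "eigenvalue ((sum_matrix K ps)\<^sup>T * sum_matrix K ps) (2 * real K + 1 - \<mu>)"
proof -
  let ?G = "(sum_matrix K ps)\<^sup>T * sum_matrix K ps"
  let ?v = "vec K (\<lambda>i. x (i + 1))"
  have G: "?G \<in> carrier_mat K K"
    using sum_matrix_carrier[where K = K and ps = ps] by auto
  \<comment> \<open>Summing up \<open>rec\<close>: at \<open>m = 0\<close> the tail is empty and the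
    equation is \<open>init\<close>. Vector entry \<open>m\<close> later uses the equation at
    \<open>m + 1\<close>.\<close>
  have tail: "(\<mu> - real m) * x m = 2 * (\<Sum>i = K + 1 - m..K. x i)" if "m \<le> K" for m
    using that
  proof (induction m)
    case (Suc m)
    have "(\<Sum>i = K - m..K. x i) = x (K - m) + (\<Sum>i = K + 1 - m..K. x i)"
      using Suc.prems by (subst sum.atLeast_Suc_atMost) (auto simp: Suc_diff_le)
    then show ?case
      using Suc rec[of m] by (simp add: algebra_simps)
  qed (use init in auto)
  have "?G *\<^sub>v ?v = (2 * real K + 1 - \<mu>) \<cdot>\<^sub>v ?v"
  proof (rule eq_vecI)
    fix m assume "m < dim_vec ((2 * real K + 1 - \<mu>) \<cdot>\<^sub>v ?v)"
    then have m: "m < K" by simp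
    then show "(?G *\<^sub>v ?v) $ m = ((2 * real K + 1 - \<mu>) \<cdot>\<^sub>v ?v) $ m"
      using tail[of "m + 1"] by (subst gram_mult_vec[OF ps m]) (simp add: algebra_simps)
  qed (use G in auto)
  moreover have "?v $ (p - 1) \<noteq> 0\<^sub>v K $ (p - 1)"
    using nz by auto
  then have "?v \<noteq> 0\<^sub>v K" by force
  ultimately have "eigenvector ?G ?v (2 * real K + 1 - \<mu>)"
    using G unfolding eigenvector_def by auto
  then show ?thesis
    unfolding eigenvalue_def by blast
qed

text \<open>
  \<open>low_eigvec K a\<close> belongs to the eigenvalue \<open>2 * K + 1 - a\<close> and is supported on \<open>{a..K - a}\<close>;
  \<open>high_eigvec K b\<close> belongs to \<open>K + 1 + b\<close> and is supported on \<open>{b + 1..K - b}\<close>. Both are affine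
  on their support except at one end point. They were found by computing small cases. For \<open>a = 0\<close>,
  the value at index \<open>0\<close> is not a vector entry.
\<close>

definition low_eigvec :: "nat \<Rightarrow> nat \<Rightarrow> nat \<Rightarrow> real" where
  "low_eigvec K a m =
     (let n = real K - 2 * real a in
      if m < a \<or> m > K - a then 0
      else if m = a then n * (n - 1)
      else 6 * (real m - real a) - 4 * n - 2)"

definition high_eigvec :: "nat \<Rightarrow> nat \<Rightarrow> nat \<Rightarrow> real" where
  "high_eigvec K b m =
     (let n = real K - 2 * real b in
      if m \<le> b \<or> m > K - b then 0
      else if m = K - b then (n - 1) * (n - 2)
      else 2 * (n + 1 - 3 * (real m - real b)))"

text \<open>The cases follow the position of \<open>m\<close> relative to the support, which
  \<open>m \<mapsto> K - m\<close> preserves. The exceptional value at \<open>a\<close> has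
  coefficient zero on the left; it enters only on the right, at \<open>m = K - a\<close>, and that
  equation dictates \<open>n * (n - 1)\<close>.\<close>

lemma low_eigvec_recurrence:
  assumes "2 * a + 2 \<le> K" "m < K"
  shows "(real a - real m - 1) * low_eigvec K a (Suc m) - (real a - real m) * low_eigvec K a m
    = 2 * low_eigvec K a (K - m)"
proof -
  obtain n where K: "K = 2 * a + 2 + n" using assms(1) le_Suc_ex by blast
  consider "Suc m < a" | "Suc m = a" | "m = a" | "a < m" "m < K - a" | "m = K - a" | "m > K - a"
    by linarith
  then show ?thesis
    using assms(2)
    by cases (auto simp: low_eigvec_def Let_def K of_nat_diff algebra_simps)
qed

text \<open>Here the exceptional value sits at \<open>K - b\<close>, again with coefficient zero on
  the left; the equation at \<open>m = b\<close> dictates \<open>(n - 1) * (n - 2)\<close>.\<close>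

lemma high_eigvec_recurrence:
  assumes "2 * b + 3 \<le> K" "m < K"
  shows "(real (K - b) - real m - 1) * high_eigvec K b (Suc m) - (real (K - b) - real m) * high_eigvec K b m
    = 2 * high_eigvec K b (K - m)"
proof -
  obtain n where K: "K = 2 * b + 3 + n" using assms(1) le_Suc_ex by blast
  consider "m < b" | "m = b" | "b < m" "Suc m < K - b" | "Suc m = K - b" | "m \<ge> K - b"
    by linarith
  then show ?thesis
    using assms(2)
    by cases (auto simp: high_eigvec_def Let_def K of_nat_diff algebra_simps)
qed

lemma eigenvalue_gram_low:
  assumes "distinct ps" "set ps = index_set K" "2 * a + 2 \<le> K"
  shows "eigenvalue ((sum_matrix K ps)\<^sup>T * sum_matrix K ps) (real (2 * K + 1 - a))"
proof -
  have "eigenvalue ((sum_matrix K ps)\<^sup>T * sum_matrix K ps) (2 * real K + 1 - real a)"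
  \<comment> \<open>The entry at \<open>K - a\<close> is \<open>2 * (n - 1)\<close> with
    \<open>n = K - 2 * a \<ge> 2\<close>; the index \<open>a\<close> could be \<open>0\<close>,
    outside the vector.\<close>
  proof (rule eigenvalue_gramI[OF assms(1,2), where x = "low_eigvec K a" and p = "K - a"])
    show "low_eigvec K a (K - a) \<noteq> 0"
      using assms(3) by (auto simp: low_eigvec_def Let_def of_nat_diff)
    \<comment> \<open>Either \<open>a = 0\<close>, or \<open>0\<close> lies outside the
      support.\<close>
    show "real a * low_eigvec K a 0 = 0"
      by (simp add: low_eigvec_def Let_def)
  qed (use assms(3) low_eigvec_recurrence[OF assms(3)] in auto)
  then show ?thesis
    using assms(3) by (simp add: of_nat_diff algebra_simps)
qed

lemma eigenvalue_gram_high: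
  assumes "distinct ps" "set ps = index_set K" "2 * b + 3 \<le> K"
  shows "eigenvalue ((sum_matrix K ps)\<^sup>T * sum_matrix K ps) (real (K + 1 + b))"
proof -
  have "eigenvalue ((sum_matrix K ps)\<^sup>T * sum_matrix K ps) (2 * real K + 1 - real (K - b))"
  proof (rule eigenvalue_gramI[OF assms(1,2), where x = "high_eigvec K b" and p = "K - b"])
    \<comment> \<open>The value \<open>(n - 1) * (n - 2)\<close> is non-zero because
      \<open>n = K - 2 * b \<ge> 3\<close>.\<close>
    show "high_eigvec K b (K - b) \<noteq> 0"
      using assms(3) by (auto simp: high_eigvec_def Let_def)
    show "real (K - b) * high_eigvec K b 0 = 0"
      by (simp add: high_eigvec_def)
  qed (use assms(3) high_eigvec_recurrence[OF assms(3)] in auto)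
  then show ?thesis
    using assms(3) by (simp add: of_nat_diff algebra_simps)
qed

text \<open>The kernel vector \<open>x = real\<close> solves the recurrence with
  \<open>\<mu> = 2 * K + 1\<close>.\<close>

lemma eigenvalue_gram_zero:
  assumes "distinct ps" "set ps = index_set K" "K > 0"
  shows "eigenvalue ((sum_matrix K ps)\<^sup>T * sum_matrix K ps) 0"
  using eigenvalue_gramI[OF assms(1,2), of "2 * real K + 1" real 1] assms(3)
  by (simp add: of_nat_diff algebra_simps)

section \<open>The full spectrum and the conclusion\<close>

text \<open>The first block collects \<open>K + 1 + b\<close> for \<open>2 * b + 3 \<le> K\<close>,
  the second \<open>2 * K + 1 - a\<close> for \<open>2 * a + 2 \<le> K\<close>.\<close>

definition gram_spectrum :: "nat \<Rightarrow> nat set" where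
  "gram_spectrum K = {K + 1..<K + 1 + (K - 1) div 2} \<union> {2 * K + 2 - K div 2..2 * K + 1}"

lemma card_gram_spectrum: "card (gram_spectrum K) = K - 1"
proof -
  have "card (gram_spectrum K) = (K - 1) div 2 + K div 2"
    unfolding gram_spectrum_def by (subst card_Un_disjoint) auto
  then show ?thesis by linarith
qed

lemma eigenvalue_gram_spectrum:
  assumes ps: "distinct ps" "set ps = index_set K" and e: "e \<in> gram_spectrum K"
  shows "eigenvalue ((sum_matrix K ps)\<^sup>T * sum_matrix K ps) (real e)"
  using e unfolding gram_spectrum_def
proof
  assume "e \<in> {K + 1..<K + 1 + (K - 1) div 2}"
  then have "2 * (e - (K + 1)) + 3 \<le> K" "K + 1 + (e - (K + 1)) = e" by auto
  then show ?thesis using eigenvalue_gram_high[OF ps] by metis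
next
  assume "e \<in> {2 * K + 2 - K div 2..2 * K + 1}"
  then have "2 * (2 * K + 1 - e) + 2 \<le> K" "2 * K + 1 - (2 * K + 1 - e) = e" by auto
  then show ?thesis using eigenvalue_gram_low[OF ps] by metis
qed

lemma proots_char_poly_gram:
  assumes ps: "distinct ps" "set ps = index_set K" and K: "K > 0"
  defines "G \<equiv> (sum_matrix K ps)\<^sup>T * sum_matrix K ps"
  shows "proots (char_poly G) = mset_set (insert 0 (real ` gram_spectrum K))"
proof (rule proots_eqI_distinct_roots)
  have G: "G \<in> carrier_mat K K"
    using sum_matrix_carrier[where K = K and ps = ps] unfolding G_def by auto
  show "char_poly G \<noteq> 0"
    using degree_monic_char_poly[OF G] by auto
  show "finite (insert 0 (real ` gram_spectrum K))"
    by (simp add: gram_spectrum_def)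
  \<comment> \<open>With \<open>0\<close> as an extra element, the \<open>K - 1\<close> positive
    eigenvalues reach the degree \<open>K\<close>.\<close>
  have "0 \<notin> real ` gram_spectrum K"
    by (auto simp: gram_spectrum_def)
  then have "card (insert 0 (real ` gram_spectrum K)) = K"
    using K card_gram_spectrum[of K] by (simp add: card_image gram_spectrum_def)
  then show "degree (char_poly G) \<le> card (insert 0 (real ` gram_spectrum K))"
    using degree_monic_char_poly[OF G] by simp
  fix x assume "x \<in> insert 0 (real ` gram_spectrum K)"
  then have "eigenvalue G x"
    using eigenvalue_gram_zero[OF ps K] eigenvalue_gram_spectrum[OF ps] unfolding G_def by auto
  then show "poly (char_poly G) x = 0"
    using eigenvalue_root_char_poly[OF G] by simp
qed

theorem lemma4p7:
  fixes K :: nat and ps :: "(nat \<times> nat) list" and M :: "real mat"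
  assumes "K \<ge> 2"
    and "distinct ps" and "set ps = index_set K"
    and "M = sum_matrix K ps"
  shows "vec_space.rank (dim_row M) M = K - 1
    \<and> mat_kernel M =
        LinearCombinations.module.span class_ring (module_vec TYPE(real) K)
          {vec K (\<lambda>i. real (i + 1))}
    \<and> size {#x \<in># proots (char_poly (M\<^sup>T * M)). x \<noteq> 0#} = K - 1
    \<and> (\<forall>x. eigenvalue (M\<^sup>T * M) x \<and> x \<noteq> 0 \<longrightarrow>
          x \<in> \<int> \<and> x \<in> {real (K + 1)..real (2 * K + 1)})"
proof -
  have M: "M \<in> carrier_mat (length ps) K"
    using assms(4) sum_matrix_carrier by simp
  then have G: "M\<^sup>T * M \<in> carrier_mat K K" by auto
  have roots: "proots (char_poly (M\<^sup>T * M)) = mset_set (insert 0 (real ` gram_spectrum K))"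
    using proots_char_poly_gram[OF assms(2,3)] assms(1,4) by simp
  have fin: "finite (real ` gram_spectrum K)" and pos: "0 \<notin> real ` gram_spectrum K"
    by (auto simp: gram_spectrum_def)
  have "vec_space.rank (dim_row M) M = K - 1"
    using rank_sum_matrix[OF assms(3)] assms(1,4) M by auto
  moreover have "mat_kernel M = LinearCombinations.module.span class_ring (module_vec TYPE(real) K)
      {vec K (\<lambda>i. real (i + 1))}"
    using mat_kernel_sum_matrix[OF assms(3)] vec_space.span_singleton[of "vec K (\<lambda>i. real (i + 1))" K] assms(4)
    by simp
  \<comment> \<open>Since \<open>0\<close> is a simple root, filtering it out removes exactly one of
    the \<open>K\<close> roots.\<close>
  moreover have "{x \<in> insert 0 (real ` gram_spectrum K). x \<noteq> 0} = real ` gram_spectrum K"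
    using pos by auto
  then have "{#x \<in># proots (char_poly (M\<^sup>T * M)). x \<noteq> 0#} = mset_set (real ` gram_spectrum K)"
    using fin unfolding roots by (subst filter_mset_mset_set) auto
  then have "size {#x \<in># proots (char_poly (M\<^sup>T * M)). x \<noteq> 0#} = K - 1"
    by (simp add: card_image card_gram_spectrum)
  moreover have "x \<in> \<int> \<and> x \<in> {real (K + 1)..real (2 * K + 1)}"
    if x: "eigenvalue (M\<^sup>T * M) x" "x \<noteq> 0" for x
  proof -
    have "char_poly (M\<^sup>T * M) \<noteq> 0"
      using degree_monic_char_poly[OF G] by auto
    then have "x \<in># proots (char_poly (M\<^sup>T * M))"
      using x(1) eigenvalue_root_char_poly[OF G] by simp
    then obtain e where e: "e \<in> gram_spectrum K" "x = real e"
      using x(2) fin unfolding roots by auto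
    then have "K + 1 \<le> e" "e \<le> 2 * K + 1"
      by (auto simp: gram_spectrum_def)
    then show ?thesis
      using e(2) by simp
  qed
  ultimately show ?thesis by blast
qed

end
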